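(* For all $L\in\mathbf N$ and $a\in\mathbb Z$, $$\sum_{k\geq0} C_{L,k}(q)\begin{bmatrix} k\\ \left\lfloor\frac{k-a}{2}\right\rfloor\end{bmatrix}_q=q^{T(a)}\begin{bmatrix} 2L+1\\ L-a\end{bmatrix}_q,$$ where $$C_{L,k}(q)=\sum_{m=0}^L q^{T(m)+T(m+k)}\begin{bmatrix} L\\ m,k\end{bmatrix}_q .$$
   Context: $\mathbf N$ denotes the set of nonnegative integers. For $m\in\mathbf N$, $(q)_m=\prod_{j=1}^m(1-q^j)$, with $(q)_0=1$. The $q$-binomial coefficient is $\begin{bmatrix} m+n\\ m\end{bmatrix}_q=\frac{(q)_{m+n}}{(q)_m(q)_n}$ if $m,n\in\mathbf N$, and it is $0$ otherwise (so $\begin{bmatrix} A\\ B\end{bmatrix}_q=0$ unless $0\le B\le A$). For $j\in\mathbb Z$, $T(j)=\binom{j+1}{2}=\frac{j(j+1)}{2}$. Moreover $\begin{bmatrix} L\\ m,k\end{bmatrix}_q=\begin{bmatrix} L\\ m\end{bmatrix}_q\begin{bmatrix} L-m\\ k\end{bmatrix}_q$. *)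

theory Defs
  imports Main "HOL-Library.Groups_Big_Fun"
begin

text \<open>
  The parameter \<open>q\<close> ranges over an arbitrary field. It is meant to be used for \<open>q\<close> that is not a root
  of unity, so that no denominator below vanishes: this covers the indeterminate of a field of
  rational functions as well as complex numbers with \<open>\<bar>q\<bar> < 1\<close>.
\<close>

definition qpoch :: "'a::field \<Rightarrow> nat \<Rightarrow> 'a" where
  "qpoch q m = (\<Prod>j=1..m. 1 - q ^ j)"

text \<open>Integer arguments, since \<open>L - a\<close> and \<open>\<lfloor>(k - a) / 2\<rfloor>\<close> may be negative.\<close>

definition qbinom :: "'a::field \<Rightarrow> int \<Rightarrow> int \<Rightarrow> 'a" where
  "qbinom q A B =
     (if 0 \<le> B \<and> B \<le> A
      then qpoch q (nat A) / (qpoch q (nat B) * qpoch q (nat (A - B)))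
      else 0)"

definition qtrinom :: "'a::field \<Rightarrow> int \<Rightarrow> int \<Rightarrow> int \<Rightarrow> 'a" where
  "qtrinom q L m k = qbinom q L m * qbinom q (L - m) k"

definition T :: "int \<Rightarrow> int" where
  "T j = j * (j + 1) div 2"

definition C :: "'a::field \<Rightarrow> nat \<Rightarrow> nat \<Rightarrow> 'a" where
  "C q L k = (\<Sum>m=0..L. q powi (T (int m) + T (int m + int k)) * qtrinom q (int L) (int m) (int k))"

text \<open>
  The following two facts ensure that sums over all \<open>k\<close> weighted by \<open>C q L k\<close> have finite support,
  so that \<^const>\<open>Sum_any\<close> is not applied outside its intended domain.
\<close>

lemma C_eq_0: "C q L k = 0" if "k > L"
  using that by (auto simp: C_def qtrinom_def qbinom_def intro!: sum.neutral)

lemma finite_support_C: "finite {k. C q L k * f k \<noteq> 0}"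
proof (rule finite_subset)
  show "{k. C q L k * f k \<noteq> 0} \<subseteq> {..L}"
    using C_eq_0[of L _ q] by (auto simp: not_less[symmetric])
qed simp

end

theory Submission
  imports Defs
begin

text \<open>
  Both sides satisfy the recurrence
  \<open>F (L + 1) a = (1 + q ^ (2 * L + 2)) * F L a + q ^ (L + 1) * (F L (a - 1) + F L (a + 1))\<close>.
  On the right-hand side this is the \<open>q\<close>-Pascal rule applied twice. On the left-hand side the functions
  \<open>h k a = qbinom q k ((k - a) div 2)\<close> are the coefficients of the Rogers--Szego polynomials, so that
  \<open>h k (a - 1) + h k (a + 1) = h (k + 1) a + (1 - q ^ k) * h (k - 1) a\<close>; the recurrence for the
  \<open>C q L k\<close> that remains holds term by term in the sum over \<open>m\<close>.
\<close>

section \<open>Triangular exponents and powers with integer exponent\<close>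

definition triangle :: "nat \<Rightarrow> nat" where
  "triangle n = n * (n + 1) div 2"

lemma triangle_0 [simp]: "triangle 0 = 0"
  by (simp add: triangle_def)

lemma triangle_Suc [simp]: "triangle (Suc n) = triangle n + Suc n"
  by (simp add: triangle_def)

lemma T_of_nat: "T (int n) = int (triangle n)"
  by (simp add: T_def triangle_def zdiv_int distrib_left)

lemma T_add_1: "T (a + 1) = T a + a + 1"
proof -
  have "(a + 1) * (a + 1 + 1) = a * (a + 1) + (a + 1) * 2"
    by (simp add: algebra_simps)
  then show ?thesis
    unfolding T_def by simp
qed

lemma T_minus_1: "T (a - 1) = T a - a"
  using T_add_1[of "a - 1"] by simp

lemma T_nonneg: "0 \<le> T a"
proof -
  have "0 \<le> a * (a + 1)"
    by (cases "0 \<le> a") (auto intro: mult_nonpos_nonpos)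
  then show ?thesis
    by (simp add: T_def)
qed

text \<open>The base may be zero, since \<open>q = 0\<close> is compatible with \<open>q\<close> not
  being a root of unity. The exponent law then fails only for opposite nonzero exponents, which the
  sign conditions exclude.\<close>

lemma power_int_add_nonneg:
  fixes x :: "'a::field"
  assumes "0 \<le> m" "0 \<le> n"
  shows "x powi (m + n) = x powi m * x powi n"
proof (cases "m + n = 0")
  case True
  with assms have "m = 0" "n = 0" by linarith+
  then show ?thesis by simp
qed (auto intro: power_int_add)

section \<open>q-Pochhammer symbols and q-binomial coefficients\<close>

lemma qpoch_0 [simp]: "qpoch q 0 = 1"
  by (simp add: qpoch_def)

lemma qpoch_Suc: "qpoch q (Suc n) = qpoch q n * (1 - q ^ Suc n)"
  by (simp add: qpoch_def)

lemma qbinom_eq_0: "B < 0 \<or> A < B \<Longrightarrow> qbinom q A B = 0"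
  by (auto simp: qbinom_def)

lemma qbinom_of_nat:
  "qbinom q (int (m + n)) (int m) = qpoch q (m + n) / (qpoch q m * qpoch q n)"
  by (simp add: qbinom_def nat_add_distrib)

lemma qbinom_symmetric: "qbinom q A (A - B) = qbinom q A B"
  by (simp add: qbinom_def mult.commute)

text \<open>The summand of \<open>C\<close> as a single q-multinomial quotient with natural
  exponents, which behave uniformly even at \<open>q = 0\<close>. The guard excludes the range where
  \<open>L - m - k\<close> would be truncated.\<close>

definition C_term :: "'a::field \<Rightarrow> nat \<Rightarrow> nat \<Rightarrow> nat \<Rightarrow> 'a" where
  "C_term q L m k =
     (if m + k \<le> L
      then q ^ (triangle m + triangle (m + k)) *
             qpoch q L / (qpoch q m * qpoch q k * qpoch q (L - m - k))
      else 0)"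

context
  fixes q :: "'a::field"
  assumes not_root_of_unity: "\<And>j::nat. j \<ge> 1 \<Longrightarrow> q ^ j \<noteq> 1"
begin

lemma power_Suc_neq_1 [simp]: "q ^ Suc n \<noteq> 1" "q * q ^ n \<noteq> 1"
  using not_root_of_unity[of "Suc n"] by auto

lemma qpoch_nonzero [simp]: "qpoch q n \<noteq> 0"
  by (induction n) (auto simp: qpoch_Suc)

section \<open>q-Pascal rules and absorption\<close>

lemma qbinom_same: "0 \<le> A \<Longrightarrow> qbinom q A A = 1"
  by (simp add: qbinom_def)

lemma qbinom_0_right: "0 \<le> A \<Longrightarrow> qbinom q A 0 = 1"
  by (simp add: qbinom_def)

text \<open>In the interior this is the splitting of \<open>1 - q ^ (A + 1)\<close> as
  \<open>1 - q ^ B\<close> plus \<open>q ^ B\<close> times \<open>1 - q ^ (A + 1 - B)\<close>. A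
  negative \<open>B\<close> is harmless because all three coefficients vanish.\<close>

lemma qbinom_pascal:
  assumes "0 \<le> A"
  shows "qbinom q (A + 1) B = qbinom q A (B - 1) + q powi B * qbinom q A B"
proof -
  consider "B < 0 \<or> A + 1 < B" | "B = 0" | "B = A + 1" | "1 \<le> B" "B \<le> A"
    by linarith
  then show ?thesis
  proof cases
    case 1
    then show ?thesis by (auto simp: qbinom_eq_0)
  next
    case 2
    then show ?thesis using assms by (simp add: qbinom_0_right qbinom_eq_0)
  next
    case 3
    then show ?thesis using assms by (simp add: qbinom_same qbinom_eq_0)
  next
    case 4
    define m where "m = nat (B - 1)"
    define n where "n = nat (A - B)"
    have B: "B = int (Suc m)" and A: "A = int (Suc m + n)"
      using 4 by (auto simp: m_def n_def)
    have 1: "qbinom q (A + 1) B = qpoch q (Suc (Suc (m + n))) / (qpoch q (Suc m) * qpoch q (Suc n))"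
      using qbinom_of_nat[of q "Suc m" "Suc n"] by (simp add: A B algebra_simps)
    have 2: "qbinom q A (B - 1) = qpoch q (Suc (m + n)) / (qpoch q m * qpoch q (Suc n))"
      using qbinom_of_nat[of q m "Suc n"] by (simp add: A B algebra_simps)
    have 3: "qbinom q A B = qpoch q (Suc (m + n)) / (qpoch q (Suc m) * qpoch q n)"
      using qbinom_of_nat[of q "Suc m" n] by (simp add: A B)
    have 4: "q powi B = q ^ Suc m"
      by (simp only: B power_int_of_nat)
    have "1 - q ^ Suc (Suc (m + n)) = (1 - q ^ Suc m) + q ^ Suc m * (1 - q ^ Suc n)"
      by (simp add: algebra_simps power_add)
    then have "qpoch q (Suc (Suc (m + n))) =
        qpoch q (Suc (m + n)) * ((1 - q ^ Suc m) + q ^ Suc m * (1 - q ^ Suc n))"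
      by (simp only: qpoch_Suc)
    then show ?thesis
      unfolding 1 2 3 4
      by (simp add: qpoch_Suc[of q m] qpoch_Suc[of q n] divide_simps del: power_Suc)
        (simp add: algebra_simps)
  qed
qed

text \<open>The mirror image of the first rule under the symmetry that exchanges \<open>B\<close>
  and \<open>A + 1 - B\<close>.\<close>

lemma qbinom_pascal':
  assumes "0 \<le> A"
  shows "qbinom q (A + 1) B = qbinom q A B + q powi (A + 1 - B) * qbinom q A (B - 1)"
proof -
  have "qbinom q (A + 1) B = qbinom q (A + 1) (A + 1 - B)"
    by (simp add: qbinom_symmetric)
  also have "\<dots> = qbinom q A (A - B) + q powi (A + 1 - B) * qbinom q A (A - (B - 1))"
    using qbinom_pascal[OF assms, of "A + 1 - B"] by (simp add: algebra_simps)
  finally show ?thesis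
    by (simp only: qbinom_symmetric)
qed

lemma qbinom_absorb:
  "(1 - q ^ k) * qbinom q (int k - 1) (B - 1) = (1 - q powi B) * qbinom q (int k) B"
proof (cases "1 \<le> B \<and> B \<le> int k")
  case True
  define m where "m = nat (B - 1)"
  define n where "n = nat (int k - B)"
  have B: "B = int (Suc m)" and k: "k = Suc m + n"
    using True by (auto simp: m_def n_def)
  have 1: "qbinom q (int k - 1) (B - 1) = qpoch q (m + n) / (qpoch q m * qpoch q n)"
    using qbinom_of_nat[of q m n] by (simp add: k B)
  have 2: "qbinom q (int k) B = qpoch q (Suc (m + n)) / (qpoch q (Suc m) * qpoch q n)"
    using qbinom_of_nat[of q "Suc m" n] by (simp add: k B)
  have 3: "q powi B = q ^ Suc m" "q ^ k = q ^ Suc (m + n)"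
    by (simp_all only: B k power_int_of_nat add_Suc)
  show ?thesis
    unfolding 1 2 3 by (simp add: qpoch_Suc divide_simps del: power_Suc)
next
  case False
  then show ?thesis by (cases "B = 0") (auto simp: qbinom_eq_0)
qed

section \<open>The Rogers--Szego three-term recurrence\<close>

lemma qbinom_three_term:
  "qbinom q (int k + 1) B + (1 - q ^ k) * qbinom q (int k - 1) (B - 1) =
   qbinom q (int k) B + qbinom q (int k) (B - 1)"
  \<comment> \<open>After absorption, the part \<open>- q powi B * qbinom q (int k) B\<close>
    cancels the weighted term of the Pascal rule.\<close>
  unfolding qbinom_absorb using qbinom_pascal[of "int k" B] by (simp add: algebra_simps)

text \<open>Each of the four floors equals \<open>B\<close> or \<open>B - 1\<close>, whatever the
  parity of \<open>k - a\<close>, so one three-term identity covers both parities.\<close>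

lemma rogers_szego_recurrence:
  "qbinom q (int k) ((int k - (a - 1)) div 2) + qbinom q (int k) ((int k - (a + 1)) div 2) =
   qbinom q (int (Suc k)) ((int (Suc k) - a) div 2) +
   (1 - q ^ k) * qbinom q (int k - 1) ((int k - 1 - a) div 2)"
proof -
  define B where "B = (int k + 1 - a) div 2"
  have "(int k - (a - 1)) div 2 = B" "(int k - (a + 1)) div 2 = B - 1"
    "(int (Suc k) - a) div 2 = B" "(int k - 1 - a) div 2 = B - 1"
    by (auto simp: B_def algebra_simps)
  then show ?thesis
    using qbinom_three_term[of k B] by (simp add: add.commute)
qed

section \<open>The recurrence for the right-hand side\<close>

lemma qbinom_pascal_twice:
  assumes "0 \<le> A"
  shows "qbinom q (A + 2) B =
    (1 + q powi (A + 1)) * qbinom q A (B - 1) +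
    q powi B * qbinom q A B + q powi (A + 2 - B) * qbinom q A (B - 2)"
proof -
  \<comment> \<open>The two mixed paths through Pascal's triangle both end at \<open>B - 1\<close>,
    one with weight 1 and the other with weight \<open>q powi (A + 1)\<close>.\<close>
  have eq: "q powi B * (q powi (A + 1 - B) * qbinom q A (B - 1)) = q powi (A + 1) * qbinom q A (B - 1)"
  proof (cases "0 \<le> B - 1 \<and> B - 1 \<le> A")
    case True
    then show ?thesis
      using power_int_add_nonneg[of B "A + 1 - B" q] by simp
  next
    case False
    then show ?thesis by (auto simp: qbinom_eq_0)
  qed
  have "qbinom q (A + 2) B = qbinom q (A + 1) (B - 1) + q powi B * qbinom q (A + 1) B"
    using qbinom_pascal[of "A + 1" B] assms by (simp add: algebra_simps)
  also have "qbinom q (A + 1) (B - 1) = qbinom q A (B - 1) + q powi (A + 2 - B) * qbinom q A (B - 2)"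
    using qbinom_pascal'[OF assms, of "B - 1"] by (simp add: algebra_simps)
  also have "qbinom q (A + 1) B = qbinom q A B + q powi (A + 1 - B) * qbinom q A (B - 1)"
    by (rule qbinom_pascal'[OF assms])
  finally show ?thesis
    by (simp add: eq distrib_left distrib_right)
qed

lemma qbinom_odd_recurrence:
  fixes L :: nat
  defines "g \<equiv> \<lambda>L::nat. \<lambda>a. q powi T a * qbinom q (2 * int L + 1) (int L - a)"
  shows "g (Suc L) a = (1 + q ^ (2 * L + 2)) * g L a + q ^ (L + 1) * (g L (a - 1) + g L (a + 1))"
proof -
  define A where "A = 2 * int L + 1"
  define B where "B = int L + 1 - a"
  \<comment> \<open>\<open>n\<close> can be negative only where the q-binomial vanishes, so the
    exponent law is applied to nonnegative exponents only.\<close>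
  have shift: "q powi T a * (q powi n * qbinom q A b) = q ^ (L + 1) * (q powi s * qbinom q A b)"
    if "T a + n = int (L + 1) + s" "0 \<le> s" "0 \<le> b \<and> b \<le> A \<Longrightarrow> 0 \<le> n" for n b s
  proof (cases "0 \<le> b \<and> b \<le> A")
    case True
    then have "q powi T a * q powi n = q ^ (L + 1) * q powi s"
      using that power_int_add_nonneg[of "T a" n q] power_int_add_nonneg[of "int (L + 1)" s q]
      by (simp only: T_nonneg power_int_of_nat of_nat_0_le_iff)
    then show ?thesis
      by (simp only: mult.assoc[symmetric])
  next
    case False
    then show ?thesis by (auto simp: qbinom_eq_0)
  qed
  have "q powi (A + 1) = q ^ (2 * L + 2)"
    using power_int_of_nat[of q "2 * L + 2"] by (simp add: A_def algebra_simps)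
  moreover have "q powi T a * (q powi B * qbinom q A B) = q ^ (L + 1) * g L (a - 1)"
  proof -
    have "T a + B = int (L + 1) + T (a - 1)"
      by (simp add: T_minus_1 B_def)
    then have "q powi T a * (q powi B * qbinom q A B) = q ^ (L + 1) * (q powi T (a - 1) * qbinom q A B)"
      by (rule shift) (use T_nonneg in auto)
    moreover have "B = int L - (a - 1)"
      by (simp add: B_def)
    ultimately show ?thesis
      by (simp only: g_def A_def)
  qed
  moreover have "q powi T a * (q powi (A + 2 - B) * qbinom q A (B - 2)) = q ^ (L + 1) * g L (a + 1)"
  proof -
    have "T a + (A + 2 - B) = int (L + 1) + T (a + 1)"
      by (simp add: T_add_1 A_def B_def)
    then have "q powi T a * (q powi (A + 2 - B) * qbinom q A (B - 2)) =
        q ^ (L + 1) * (q powi T (a + 1) * qbinom q A (B - 2))"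
      by (rule shift) (use T_nonneg in auto)
    moreover have "B - 2 = int L - (a + 1)"
      by (simp add: B_def)
    ultimately show ?thesis
      by (simp only: g_def A_def)
  qed
  moreover have "g (Suc L) a = q powi T a * qbinom q (A + 2) B"
    by (simp add: g_def A_def B_def algebra_simps)
  moreover have "g L a = q powi T a * qbinom q A (B - 1)"
    by (simp add: g_def A_def B_def)
  moreover have "0 \<le> A"
    by (simp add: A_def)
  ultimately show ?thesis
    by (simp add: qbinom_pascal_twice distrib_left distrib_right mult_ac)
qed

section \<open>The recurrence for the coefficients \<open>C q L k\<close>\<close>

lemma C_term_eq:
  "q powi (T (int m) + T (int m + int k)) * qtrinom q (int L) (int m) (int k) = C_term q L m k"
proof (cases "m + k \<le> L")
  case True
  then obtain n where L: "L = m + k + n"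
    using le_Suc_ex by blast
  have "qbinom q (int L) (int m) = qpoch q L / (qpoch q m * qpoch q (k + n))"
    using qbinom_of_nat[of q m "k + n"] by (simp add: L add_ac)
  moreover have "qbinom q (int L - int m) (int k) = qpoch q (k + n) / (qpoch q k * qpoch q n)"
    using qbinom_of_nat[of q k n] by (simp add: L)
  moreover have "q powi (T (int m) + T (int m + int k)) = q ^ (triangle m + triangle (m + k))"
    using power_int_of_nat[of q "triangle m + triangle (m + k)"]
    by (simp add: T_of_nat flip: of_nat_add)
  ultimately show ?thesis
    by (simp add: qtrinom_def C_term_def L)
next
  case False
  then show ?thesis by (auto simp: C_term_def qtrinom_def qbinom_eq_0)
qed

text \<open>The free upper bound \<open>M\<close> allows sums belonging to \<open>L\<close> and to
  \<open>Suc L\<close> to run over the same range.\<close>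

lemma C_eq_sum_C_term:
  assumes "L \<le> M"
  shows "C q L k = (\<Sum>m\<le>M. C_term q L m k)"
proof -
  have "C q L k = (\<Sum>m\<in>{0..L}. C_term q L m k)"
    by (simp add: C_def C_term_eq)
  also have "\<dots> = (\<Sum>m\<le>M. C_term q L m k)"
    using assms by (intro sum.mono_neutral_left) (auto simp: C_term_def)
  finally show ?thesis .
qed

text \<open>With \<open>Suc L = m + k + n\<close>, division by a common factor leaves the
  telescoping identity \<open>1 - q ^ (m + k + n) = (1 - q ^ n) + q ^ n * (1 - q ^ k) + q ^ (n + k)
  * (1 - q ^ m)\<close>. The last summand is split by \<open>1 = (1 - q ^ n) + q ^ n\<close> into
  the two terms at \<open>m - 1\<close>.\<close>

lemma C_term_recurrence:
  "C_term q (Suc L) m k =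
     C_term q L m k +
     q ^ Suc L * (case k of 0 \<Rightarrow> 0 | Suc k' \<Rightarrow> C_term q L m k') +
     (case m of 0 \<Rightarrow> 0 | Suc m' \<Rightarrow>
        q ^ Suc L * (1 - q ^ Suc k) * C_term q L m' (Suc k) + q ^ (2 * L + 2) * C_term q L m' k)"
proof (cases "m + k \<le> Suc L")
  case False
  then show ?thesis by (auto simp: C_term_def split: nat.splits)
next
  case True
  then obtain n where L: "Suc L = m + k + n"
    using le_Suc_ex by blast
  \<comment> \<open>This is \<open>C_term q (Suc L) m k\<close> without the last factor
    \<open>1 - q ^ Suc L\<close> of \<open>qpoch q (Suc L)\<close>.\<close>
  define A where "A = q ^ (triangle m + triangle (m + k)) * qpoch q L / (qpoch q m * qpoch q k * qpoch q n)"
  have 0: "C_term q (Suc L) m k = A * (1 - q ^ (m + k + n))"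
    using L qpoch_Suc[of q L] by (simp add: C_term_def A_def del: power_Suc)
  \<comment> \<open>At the boundaries \<open>n = 0\<close>, \<open>k = 0\<close> and
    \<open>m = 0\<close>, here and below, the missing terms match the vanishing factors
    \<open>1 - q ^ 0\<close>.\<close>
  have 1: "C_term q L m k = A * (1 - q ^ n)"
  proof (cases n)
    case (Suc n')
    with L have "L = m + k + n'" by simp
    then show ?thesis
      by (simp add: C_term_def A_def Suc qpoch_Suc)
  qed (use L in \<open>simp add: C_term_def\<close>)
  have 2: "q ^ Suc L * (case k of 0 \<Rightarrow> 0 | Suc k' \<Rightarrow> C_term q L m k') = A * (q ^ n * (1 - q ^ k))"
  proof (cases k)
    case (Suc k')
    with L have L': "L = m + k' + n" by simp
    let ?D = "qpoch q m * qpoch q k' * qpoch q n"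
    have "q ^ Suc L * C_term q L m k' =
        q ^ Suc L * q ^ (triangle m + triangle (m + k')) * (qpoch q L / ?D)"
      by (simp add: C_term_def L')
    \<comment> \<open>Passing from \<open>k'\<close> to \<open>k\<close> uses up
      \<open>m + k\<close> of the exponent \<open>Suc L = m + k + n\<close>.\<close>
    also have "q ^ Suc L * q ^ (triangle m + triangle (m + k')) =
        q ^ (triangle m + triangle (m + k)) * q ^ n"
      by (simp add: L' Suc add_ac flip: power_add power_Suc)
    also have "\<dots> * (qpoch q L / ?D) = A * (q ^ n * (1 - q ^ k))"
      by (simp add: A_def Suc qpoch_Suc mult_ac del: power_Suc)
    finally show ?thesis
      by (simp only: Suc nat.case)
  qed simp
  have 3: "(case m of 0 \<Rightarrow> 0 | Suc m' \<Rightarrow>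
        q ^ Suc L * (1 - q ^ Suc k) * C_term q L m' (Suc k) + q ^ (2 * L + 2) * C_term q L m' k) =
      A * (q ^ (n + k) * (1 - q ^ m) * (1 - q ^ n)) + A * (q ^ (2 * n + k) * (1 - q ^ m))"
  proof (cases m)
    case (Suc m')
    with L have L': "L = m' + k + n" by simp
    have "q ^ Suc L * (1 - q ^ Suc k) * C_term q L m' (Suc k) =
        A * (q ^ (n + k) * (1 - q ^ m) * (1 - q ^ n))"
    proof (cases n)
      case n: (Suc n')
      let ?D = "qpoch q m' * qpoch q (Suc k) * qpoch q n'"
      have "q ^ Suc L * (1 - q ^ Suc k) * C_term q L m' (Suc k) =
          q ^ Suc L * q ^ (triangle m' + triangle (m' + Suc k)) *
          ((1 - q ^ Suc k) * qpoch q L / ?D)"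
        by (simp add: C_term_def L' n mult_ac del: power_Suc)
      \<comment> \<open>Since \<open>m' + Suc k = m + k\<close>, only the first triangular number
        changes, by \<open>m\<close>.\<close>
      also have "q ^ Suc L * q ^ (triangle m' + triangle (m' + Suc k)) =
          q ^ (triangle m + triangle (m + k)) * q ^ (n + k)"
        by (simp add: L' Suc add_ac flip: power_add power_Suc)
      also have "\<dots> * ((1 - q ^ Suc k) * qpoch q L / ?D) =
          A * (q ^ (n + k) * (1 - q ^ m) * (1 - q ^ n))"
        by (simp add: A_def n Suc qpoch_Suc mult_ac del: power_Suc)
      finally show ?thesis .
    qed (simp add: C_term_def L')
    moreover have "q ^ (2 * L + 2) * C_term q L m' k = A * (q ^ (2 * n + k) * (1 - q ^ m))"
    proof -
      let ?D = "qpoch q m' * qpoch q k * qpoch q n"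
      have "q ^ (2 * L + 2) * C_term q L m' k =
          q ^ (2 * L + 2) * q ^ (triangle m' + triangle (m' + k)) * (qpoch q L / ?D)"
        by (simp add: C_term_def L')
      \<comment> \<open>Both triangular numbers grow here, by \<open>m\<close> and by
        \<open>m + k\<close>, leaving \<open>2 * n + k\<close> of
        \<open>2 * (m + k + n)\<close>.\<close>
      also have "q ^ (2 * L + 2) * q ^ (triangle m' + triangle (m' + k)) =
          q ^ (triangle m + triangle (m + k)) * q ^ (2 * n + k)"
        by (simp add: L' Suc add_ac mult_2 flip: power_add power_Suc)
      also have "\<dots> * (qpoch q L / ?D) = A * (q ^ (2 * n + k) * (1 - q ^ m))"
        by (simp add: A_def Suc qpoch_Suc mult_ac del: power_Suc)
      finally show ?thesis .
    qed
    ultimately show ?thesis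
      by (simp only: Suc nat.case)
  qed simp
  show ?thesis
    unfolding 0 1 2 3 by (simp add: algebra_simps power_add mult_2_right)
qed

text \<open>Summation of the termwise recurrence over \<open>m \<le> Suc L\<close>; the terms at
  \<open>m - 1\<close> reindex exactly to the range \<open>m \<le> L\<close>.\<close>

lemma C_recurrence:
  "C q (Suc L) k = (1 + q ^ (2 * L + 2)) * C q L k +
     q ^ Suc L * ((case k of 0 \<Rightarrow> 0 | Suc k' \<Rightarrow> C q L k') + (1 - q ^ Suc k) * C q L (Suc k))"
proof -
  have "(\<Sum>m\<le>Suc L. case m of 0 \<Rightarrow> 0 | Suc m' \<Rightarrow>
        q ^ Suc L * (1 - q ^ Suc k) * C_term q L m' (Suc k) + q ^ (2 * L + 2) * C_term q L m' k) =
      q ^ Suc L * (1 - q ^ Suc k) * C q L (Suc k) + q ^ (2 * L + 2) * C q L k"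
    by (simp only: sum.atMost_Suc_shift nat.case sum.distrib sum_distrib_left[symmetric]
        C_eq_sum_C_term[OF order.refl] add_0)
  moreover have "(\<Sum>m\<le>Suc L. q ^ Suc L * (case k of 0 \<Rightarrow> 0 | Suc k' \<Rightarrow> C_term q L m k')) =
      q ^ Suc L * (case k of 0 \<Rightarrow> 0 | Suc k' \<Rightarrow> C q L k')"
    by (cases k) (simp_all only: nat.case sum_distrib_left[symmetric] sum.neutral_const
        C_eq_sum_C_term[of L "Suc L"] le_SucI order.refl)
  moreover have "(\<Sum>m\<le>Suc L. C_term q L m k) = C q L k"
    by (simp only: C_eq_sum_C_term[of L "Suc L"] le_SucI order.refl)
  ultimately show ?thesis
    unfolding C_eq_sum_C_term[OF order.refl, of "Suc L"] C_term_recurrence sum.distrib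
    by (simp only: distrib_left distrib_right mult_1 mult.assoc add_ac)
qed

text \<open>Summation by parts: the shifts in \<open>k\<close> move from \<open>C\<close> to the
  weight \<open>h\<close>, which can then be specialised to a sequence with its own three-term
  recurrence. The value \<open>h (- 1)\<close> occurs only with the factor
  \<open>1 - q ^ 0 = 0\<close>.\<close>

lemma sum_C_recurrence:
  fixes h :: "int \<Rightarrow> 'a"
  shows "(\<Sum>k\<le>Suc L. C q (Suc L) k * h (int k)) =
    (1 + q ^ (2 * L + 2)) * (\<Sum>k\<le>L. C q L k * h (int k)) +
    q ^ Suc L * (\<Sum>k\<le>L. C q L k * (h (int (Suc k)) + (1 - q ^ k) * h (int k - 1)))"
proof -
  have 1: "(\<Sum>k\<le>Suc L. C q L k * h (int k)) = (\<Sum>k\<le>L. C q L k * h (int k))"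
    by (simp add: C_eq_0)
  have 2: "(\<Sum>k\<le>Suc L. (case k of 0 \<Rightarrow> 0 | Suc k' \<Rightarrow> C q L k') * h (int k)) =
      (\<Sum>k\<le>L. C q L k * h (int (Suc k)))"
    by (simp only: sum.atMost_Suc_shift nat.case mult_zero_left add_0)
  \<comment> \<open>Two zero terms are appended at the top, so that removing the zero term at
    \<open>k = 0\<close> and shifting gives the range up to \<open>Suc L\<close>.\<close>
  have "(\<Sum>k\<le>L. C q L k * (1 - q ^ k) * h (int k - 1)) =
      (\<Sum>k\<le>Suc (Suc L). C q L k * (1 - q ^ k) * h (int k - 1))"
    by (simp add: C_eq_0)
  also have "\<dots> = (\<Sum>k\<le>Suc L. (1 - q ^ Suc k) * C q L (Suc k) * h (int k))"
    by (subst sum.atMost_Suc_shift) (simp add: mult.commute)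
  finally have 3: "(\<Sum>k\<le>Suc L. (1 - q ^ Suc k) * C q L (Suc k) * h (int k)) =
      (\<Sum>k\<le>L. C q L k * (1 - q ^ k) * h (int k - 1))" ..
  have "(\<Sum>k\<le>Suc L. C q (Suc L) k * h (int k)) =
      (1 + q ^ (2 * L + 2)) * (\<Sum>k\<le>Suc L. C q L k * h (int k)) +
      q ^ Suc L * ((\<Sum>k\<le>Suc L. (case k of 0 \<Rightarrow> 0 | Suc k' \<Rightarrow> C q L k') * h (int k)) +
        (\<Sum>k\<le>Suc L. (1 - q ^ Suc k) * C q L (Suc k) * h (int k)))"
    by (simp only: C_recurrence distrib_right sum.distrib sum_distrib_left mult.assoc distrib_left)
  then show ?thesis
    unfolding 1 2 3 by (simp only: distrib_left sum.distrib mult.assoc)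
qed

lemma sum_C_qbinom:
  "(\<Sum>k\<le>L. C q L k * qbinom q (int k) ((int k - a) div 2)) =
   q powi T a * qbinom q (2 * int L + 1) (int L - a)"
proof (induction L arbitrary: a)
  case 0
  have "C q 0 0 = 1"
    by (simp add: C_def qtrinom_def qbinom_def T_def)
  \<comment> \<open>These are the only \<open>a\<close> with \<open>qbinom q 1 (- a)\<close>
    nonzero; for both, \<open>T a = 0\<close> and \<open>- a div 2 = 0\<close>.\<close>
  moreover consider "a = 0" | "a = -1" | "a \<noteq> 0" "a \<noteq> -1"
    by blast
  then have "qbinom q 0 (- a div 2) = q powi T a * qbinom q 1 (- a)"
  proof cases
    case 3
    then have "- a < 0 \<or> 1 < - a" "- a div 2 < 0 \<or> 0 < - a div 2"
      by linarith+
    then show ?thesis by (simp add: qbinom_eq_0)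
  qed (simp_all add: T_def qbinom_0_right qbinom_same)
  ultimately show ?case by simp
next
  case (Suc L)
  show ?case
    \<comment> \<open>The Rogers--Szego recurrence, read backwards, turns the shifts in
      \<open>k\<close> into shifts in \<open>a\<close>, so the induction hypothesis applies at
      \<open>a - 1\<close>, \<open>a\<close> and \<open>a + 1\<close>.\<close>
    unfolding sum_C_recurrence[where h = "\<lambda>k. qbinom q k ((k - a) div 2)"]
      rogers_szego_recurrence[symmetric] distrib_left sum.distrib Suc.IH
      qbinom_odd_recurrence
    by (simp add: distrib_left)
qed

end

theorem theorem2p1:
  fixes q :: "'a::field" and L :: nat and a :: int
  assumes "\<And>j::nat. j \<ge> 1 \<Longrightarrow> q ^ j \<noteq> 1"
  shows "Sum_any (\<lambda>k::nat. C q L k * qbinom q (int k) ((int k - a) div 2)) =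
         q powi T a * qbinom q (2 * int L + 1) (int L - a)"
proof -
  have "Sum_any (\<lambda>k::nat. C q L k * qbinom q (int k) ((int k - a) div 2)) =
      (\<Sum>k\<le>L. C q L k * qbinom q (int k) ((int k - a) div 2))"
    using C_eq_0[of L _ q] by (intro Sum_any.expand_superset) (auto simp: not_less[symmetric])
  then show ?thesis
    using sum_C_qbinom[OF assms] by simp
qed

end
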